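(* Assume that, in the ADMM procedure described in the context, for any time-step $k\in\mathbb{Z}_{\geq 0}$, $$\lim_{S_k\rightarrow+\infty}V_k^{(T),(S_k)}((\mathbf{x}_i[k])_{i=1}^N)=V_k^{(T)}((\mathbf{x}_i[k])_{i=1}^N).$$ Let $\{\tilde V_k\}_{k=0}^\infty$ be a given family of mappings $\tilde V_k:\prod_{i=1}^N\mathcal{X}_i\rightarrow\mathbb{R}_{\geq 0}$, $k\in\mathbb{Z}_{\geq 0}$, and let $\alpha\in[0,1]$ be a given constant. In addition, let the iteration number $S_k$ in the ADMM procedure, in each time-step $k\in\mathbb{Z}_{\geq 0}$, be given such that $$\tilde V_k((\mathbf{x}_i[k])_{i=1}^N)\geq V_k^{(T),(S_k)}((\mathbf{x}_i[k])_{i=1}^N)$$ and $$V_k^{(T),(S_k)}((\mathbf{x}_i[k])_{i=1}^N)-\tilde V_{k+1}((\mathbf{x}_i[k+1])_{i=1}^N)\geq e[k]+\alpha\sum_{i=1}^N\boldsymbol{\ell}_i(\mathbf{x}_i[k],\mathbf{w}_i[k];\hat{\mathbf{u}}_i^{(S_k)}[k]),$$ where $\mathbf{x}_i[k+1]=\mathbf{f}_i(\mathbf{x}_i[k],\mathbf{v}_i[k];\hat{\mathbf{u}}_i^{(S_k)}[k])$ for each $1\leq i\leq N$ (so the applied control is $\mathbf{u}_i[k]=\hat{\mathbf{u}}_i^{(S_k)}[k]$), and the sequence $\{e[k]\}_{k=0}^\infty$ is described by $e[0]=0$, $$e[1]=\alpha\sum_{i=1}^N\boldsymbol{\ell}_i(\mathbf{x}_i[0],\mathbf{w}_i[0];\mathbf{u}_i[0])+\tilde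 V_1((\mathbf{x}_i[1])_{i=1}^N)-V_0^{(T),(S_0)}((\mathbf{x}_i[0])_{i=1}^N),$$ and, for all $k\in\mathbb{Z}_{\geq 2}$, $$e[k]=e[k-1]+\alpha\sum_{i=1}^N\boldsymbol{\ell}_i(\mathbf{x}_i[k-1],\mathbf{w}_i[k-1];\mathbf{u}_i[k-1])+\tilde V_k((\mathbf{x}_i[k])_{i=1}^N)-\tilde V_{k-1}((\mathbf{x}_i[k-1])_{i=1}^N).$$ Then, for any initial condition $(\mathbf{x}_i[0])_{i=1}^N\in\prod_{i=1}^N\mathcal{X}_i$ and any given constant $\varepsilon>0$, there exists $S_0\in\mathbb{Z}_{\geq 1}$ such that, when the procedure is run from this initial condition with $S_0$ iterations at time-step $0$ (and with iteration numbers satisfying $\tilde V_k((\mathbf{x}_i[k])_{i=1}^N)\geq V_k^{(T),(S_k)}((\mathbf{x}_i[k])_{i=1}^N)$ and $V_k^{(T),(S_k)}((\mathbf{x}_i[k])_{i=1}^N)-\tilde V_{k+1}((\mathbf{x}_i[k+1])_{i=1}^N)\geq e[k]+\alpha\sum_{i=1}^N\boldsymbol{\ell}_i(\mathbf{x}_i[k],\mathbf{w}_i[k];\hat{\mathbf{u}}_i^{(S_k)}[k])$ for all $k\in\mathbb{Z}_{\geq 0}$), $$\alpha\,J_0\big((\mathbf{x}_i[0])_{i=1}^N;(\mathbf{u}_i[0:+\infty])_{i=1}^N\big)\leq V_0((\mathbf{x}_i[0])_{i=1}^N)+\varepsilon.$$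
   Context: Notation: $\mathbb{Z}_{\geq a}^{\leq b}=\{n\in\mathbb{Z}: a\leq n\leq b\}$; $z[a:b]$ denotes the finite or infinite sequence $(z[t])_{t=a}^{b}$. $T\in\mathbb{Z}_{\geq 0}$ is a fixed horizon. Plant. $\mathcal{G}^P=(\{1,\dots,N\},\mathcal{E}^P)$ and $\mathcal{G}^C=(\{1,\dots,N\},\mathcal{E}^C)$ are given directed graphs. For each $i$, let $\mathcal{X}_i\subseteq\mathbb{R}^{n_i}$ and $\mathcal{U}_i\subseteq\mathbb{R}^{m_i}$ ($n_i,m_i\geq 1$) be given, together with a map $\mathbf{f}_i:\mathcal{X}_i\times\prod_{(j,i)\in\mathcal{E}^P}\mathcal{X}_j\times\mathcal{U}_i\rightarrow\mathcal{X}_i$. The dynamics are $\mathbf{x}_i[k+1]=\mathbf{f}_i(\mathbf{x}_i[k],\mathbf{v}_i[k];\mathbf{u}_i[k])$ with $\mathbf{v}_i[k]=(\mathbf{x}_j[k])_{(j,i)\in\mathcal{E}^P}$. Also $\mathbf{w}_i[k]=(\mathbf{x}_j[k])_{(j,i)\in\mathcal{E}^C}$. Costs. $\boldsymbol{\ell}_i:\mathcal{X}_i\times\prod_{(j,i)\in\mathcal{E}^C}\mathcal{X}_j\times\mathcal{U}_i\rightarrow\mathbb{R}_{\geq 0}$. For a state $(\mathbf{x}_i[k])_{i=1}^N$ at time $k$ and a control sequence $(\hat{\mathbf{u}}_i)_{i=1}^N$, let $\hat{\mathbf{x}}_i$ be the predicted trajectory with $\hat{\mathbf{x}}_i[k]=\mathbf{x}_i[k]$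 and $\hat{\mathbf{x}}_i[t+1]=\mathbf{f}_i(\hat{\mathbf{x}}_i[t],\hat{\mathbf{v}}_i[t];\hat{\mathbf{u}}_i[t])$, where $\hat{\mathbf{v}}_i[t]=(\hat{\mathbf{x}}_j[t])_{(j,i)\in\mathcal{E}^P}$ and $\hat{\mathbf{w}}_i[t]=(\hat{\mathbf{x}}_j[t])_{(j,i)\in\mathcal{E}^C}$. Define $$J_k\big((\mathbf{x}_i[k])_i;(\hat{\mathbf{u}}_i[k:+\infty])_i\big)=\sum_{t=k}^{\infty}\sum_{i=1}^N\boldsymbol{\ell}_i(\hat{\mathbf{x}}_i[t],\hat{\mathbf{w}}_i[t];\hat{\mathbf{u}}_i[t]),$$ $$J_k^{(T)}\big((\mathbf{x}_i[k])_i;(\hat{\mathbf{u}}_i[k:k+T])_i\big)=\sum_{t=k}^{k+T}\sum_{i=1}^N\boldsymbol{\ell}_i(\hat{\mathbf{x}}_i[t],\hat{\mathbf{w}}_i[t];\hat{\mathbf{u}}_i[t]).$$ $V_k((\mathbf{x}_i[k])_i)$ is the minimum of $J_k$ over $(\hat{\mathbf{u}}_i[k:+\infty])_i$ subject to, for all $1\leq i\leq N$, $\hat{\mathbf{x}}_i[k]=\mathbf{x}_i[k]$ and $\hat{\mathbf{x}}_i[t+1]=\mathbf{f}_i(\hat{\mathbf{x}}_i[t],\hat{\mathbf{v}}_i[t];\hat{\mathbf{u}}_i[t])$, $\hat{\mathbf{x}}_i[t]\in\mathcal{X}_i$, $\hat{\mathbf{u}}_i[t]\in\mathcal{U}_i$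 for all $t\geq k$. $V_k^{(T)}((\mathbf{x}_i[k])_i)$ is the minimum of $J_k^{(T)}$ over $(\hat{\mathbf{u}}_i[k:k+T])_i$ subject to, for all $1\leq i\leq N$, $\hat{\mathbf{x}}_i[k]=\mathbf{x}_i[k]$ and $\hat{\mathbf{x}}_i[t+1]=\mathbf{f}_i(\hat{\mathbf{x}}_i[t],\hat{\mathbf{v}}_i[t];\hat{\mathbf{u}}_i[t])$, $\hat{\mathbf{x}}_i[t]\in\mathcal{X}_i$, $\hat{\mathbf{u}}_i[t]\in\mathcal{U}_i$ for all $t\in\mathbb{Z}_{\geq k}^{\leq k+T}$. Standing assumptions. (1) For each $i$, $\boldsymbol{\ell}_i(\mathbf{x}_i,\mathbf{w}_i;\mathbf{u}_i)$ is continuous in $\mathbf{x}_i$ for all $\mathbf{x}_i\in\mathcal{X}_i$, and $\boldsymbol{\ell}_i(\mathbf{x}_i,\mathbf{w}_i;\mathbf{u}_i)=0$ if and only if $\mathbf{x}_i=0$. (2) The optimal control problem of minimizing $\sum_{t=k}^{k+T}\sum_{i=1}^N\boldsymbol{\ell}_i(\hat{\mathbf{x}}_i[t],\hat{\mathbf{w}}_i[t];\hat{\mathbf{u}}_i[t])$ over control sequences $(\hat{\mathbf{u}}_i[k:k+T])_i$ subject to, for all $1\leq i\leq N$, $\hat{\mathbf{x}}_i[k]=\mathbf{x}_i[k]$ and $\hat{\mathbf{x}}_i[t+1]=\mathbf{f}_i(\hat{\mathbf{x}}_i[t],\hat{\mathbf{v}}_i[t];\hat{\mathbf{u}}_i[t])$,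 $\hat{\mathbf{x}}_i[t]\in\mathcal{X}_i$, $\hat{\mathbf{u}}_i[t]\in\mathcal{U}_i$ for all $t\in\mathbb{Z}_{\geq k}^{\leq k+T}$, admits a unique global minimizer for every horizon $T\in\mathbb{Z}_{\geq 0}\cup\{\infty\}$. ADMM procedure. Write $\mathbf{y}_i[t]=[\hat{\mathbf{x}}_i[t]^\top,\bar{\mathbf{w}}_i[t]^\top,\hat{\mathbf{u}}_i[t]^\top,\bar{\mathbf{v}}_i[t]^\top]^\top$ and $\boldsymbol{\ell}_i(\mathbf{y}_i[t])=\boldsymbol{\ell}_i(\hat{\mathbf{x}}_i[t],\bar{\mathbf{w}}_i[t];\hat{\mathbf{u}}_i[t])$. For the current time $k$ and state $(\mathbf{x}_i[k])_i$, and $t\in\mathbb{Z}_{\geq k}^{\leq k+T}$, let $\mathcal{C}_i[t]$ be the set of vectors $[\hat{\mathbf{x}}_i[t]^\top,\bar{\mathbf{w}}_i[t]^\top,\hat{\mathbf{u}}_i[t]^\top,\bar{\mathbf{v}}_i[t]^\top]^\top$ for which the remaining forecast variables can be chosen (those of subsystem $i$ at the other times, and states $\hat{\mathbf{x}}_j[s]\in\mathcal{X}_j$ of the subsystems $j$ with $(j,i)\in\mathcal{E}^P\cup\mathcal{E}^C$) so that $\hat{\mathbf{x}}_i[k]=\mathbf{x}_i[k]$ and, for all $s\in\mathbb{Z}_{\geq k}^{\leq t}$, $\hat{\mathbf{x}}_i[s+1]=\mathbf{f}_i(\hat{\mathbf{x}}_i[s],\bar{\mathbf{v}}_i[s];\hat{\mathbf{u}}_i[s])$,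 $\hat{\mathbf{x}}_i[s]\in\mathcal{X}_i$, $\hat{\mathbf{u}}_i[s]\in\mathcal{U}_i$, $\bar{\mathbf{w}}_i[s]=\hat{\mathbf{w}}_i[s]$, $\bar{\mathbf{v}}_i[s]=\hat{\mathbf{v}}_i[s]$. The sets $\mathcal{C}_i[t]$ are assumed convex, and $\Pi_{\mathcal{C}_i[t]}$ denotes the projection onto $\mathcal{C}_i[t]$ (assumed well defined). Let $\rho>0$ be the penalty parameter. At each time-step $k=0,1,2,\dots$, initialize $\boldsymbol{\zeta}_i^{(1)}[t]$ and scaled dual variables $\boldsymbol{\gamma}_i^{(1)}[t]$, $t\in\mathbb{Z}_{\geq k}^{\leq k+T}$. For $s=1,\dots,S_k$: (i) for each $i$, let $\mathbf{y}_i^{(s)}[k:k+T]$ be a minimizer (assumed to exist) over $\mathbf{y}_i[k:k+T]$, with $(\hat{\mathbf{x}}_i[t],\bar{\mathbf{w}}_i[t],\hat{\mathbf{u}}_i[t])$ in the domain of $\boldsymbol{\ell}_i$, of $\sum_{t=k}^{k+T}\big[\boldsymbol{\ell}_i(\mathbf{y}_i[t])+\frac{\rho}{2}\|\mathbf{y}_i[t]-\boldsymbol{\zeta}_i^{(s)}[t]-\boldsymbol{\gamma}_i^{(s)}[t]\|^2\big]$; (ii) $\boldsymbol{\zeta}_i^{(s+1)}[t]=\Pi_{\mathcal{C}_i[t]}(\mathbf{y}_i^{(s)}[t]+\boldsymbol{\gamma}_i^{(s)}[t])$; (iii) $\boldsymbol{\gamma}_i^{(s+1)}[t]=\boldsymbol{\gamma}_i^{(s)}[t]+(\mathbf{y}_i^{(s)}[t]-\boldsymbol{\zeta}_i^{(s+1)}[t])$.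 After $S_k$ iterations, apply $\mathbf{u}_i[k]=\hat{\mathbf{u}}_i^{(S_k)}[k]$, where $\hat{\mathbf{u}}_i^{(s)}[t]$ is the $\hat{\mathbf{u}}_i$-component of $\mathbf{y}_i^{(s)}[t]$, and move to time $k+1$. For this procedure, $$V_k^{(T),(s)}((\mathbf{x}_i[k])_{i=1}^N)=\sum_{t=k}^{k+T}\sum_{i=1}^N\Big[\boldsymbol{\ell}_i(\mathbf{y}_i^{(s)}[t])+\frac{\rho}{2}\big\|\mathbf{y}_i^{(s)}[t]-\boldsymbol{\zeta}_i^{(s)}[t]-\boldsymbol{\gamma}_i^{(s)}[t]\big\|^2\Big].$$ *)

theory Defs
  imports "HOL-Analysis.Analysis"
begin

section \<open>The networked plant\<close>

text \<open>
  The dimensions \<open>n\<^sub>i\<close>, \<open>m\<^sub>i\<close> vary with the subsystem, so vectors are extensional functions: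
  \<open>\<real>\<^sup>A = A \<rightarrow>\<^sub>E UNIV\<close> for a finite index set \<open>A\<close>.  A tuple \<open>(x\<^sub>j)\<^sub>j\<^sub>\<in>\<^sub>B\<close> is likewise an extensional
  function on \<open>B\<close>, and Cartesian products are \<open>Pi\<^sub>E\<close>.
\<close>

type_synonym vect = "nat \<Rightarrow> real"
type_synonym tuple = "nat \<Rightarrow> vect"

abbreviation real_space :: "'a set \<Rightarrow> ('a \<Rightarrow> real) set" where
  "real_space A \<equiv> A \<rightarrow>\<^sub>E (UNIV :: real set)"

text \<open>
  Fields: the number \<open>N\<close> of subsystems, the edge sets of the plant graph and of the communication
  graph, \<open>n\<^sub>i\<close>, \<open>m\<^sub>i\<close>, \<open>\<X>\<^sub>i\<close>, \<open>\<U>\<^sub>i\<close>, \<open>f\<^sub>i(x\<^sub>i, v\<^sub>i; u\<^sub>i)\<close> and \<open>\<ell>\<^sub>i(x\<^sub>i, w\<^sub>i; u\<^sub>i)\<close>.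
\<close>

record network =
  nsub :: nat
  EP :: "(nat \<times> nat) set"
  EC :: "(nat \<times> nat) set"
  dimx :: "nat \<Rightarrow> nat"
  dimu :: "nat \<Rightarrow> nat"
  Xset :: "nat \<Rightarrow> vect set"
  Uset :: "nat \<Rightarrow> vect set"
  dyn :: "nat \<Rightarrow> vect \<Rightarrow> tuple \<Rightarrow> vect \<Rightarrow> vect"
  cost :: "nat \<Rightarrow> vect \<Rightarrow> tuple \<Rightarrow> vect \<Rightarrow> real"

definition subs :: "network \<Rightarrow> nat set" where
  "subs P = {1..nsub P}"

definition nbrP :: "network \<Rightarrow> nat \<Rightarrow> nat set" where
  "nbrP P i = {j. (j, i) \<in> EP P}"

definition nbrC :: "network \<Rightarrow> nat \<Rightarrow> nat set" where
  "nbrC P i = {j. (j, i) \<in> EC P}"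

definition states :: "network \<Rightarrow> tuple set" where
  "states P = Pi\<^sub>E (subs P) (Xset P)"

definition inputs :: "network \<Rightarrow> tuple set" where
  "inputs P = Pi\<^sub>E (subs P) (Uset P)"

definition network_ok :: "network \<Rightarrow> bool" where
  "network_ok P \<longleftrightarrow>
     EP P \<subseteq> subs P \<times> subs P \<and> EC P \<subseteq> subs P \<times> subs P \<and>
     (\<forall>i\<in>subs P.
        1 \<le> dimx P i \<and> 1 \<le> dimu P i \<and>
        Xset P i \<subseteq> real_space {..<dimx P i} \<and>
        Uset P i \<subseteq> real_space {..<dimu P i} \<and>
        (\<forall>x\<in>Xset P i. \<forall>v\<in>Pi\<^sub>E (nbrP P i) (Xset P). \<forall>u\<in>Uset P i. dyn P i x v u \<in> Xset P i) \<and>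
        (\<forall>x\<in>Xset P i. \<forall>w\<in>Pi\<^sub>E (nbrC P i) (Xset P). \<forall>u\<in>Uset P i. 0 \<le> cost P i x w u))"

definition step :: "network \<Rightarrow> tuple \<Rightarrow> tuple \<Rightarrow> tuple" where
  "step P x u = (\<lambda>i\<in>subs P. dyn P i (x i) (restrict x (nbrP P i)) (u i))"

definition stage_cost :: "network \<Rightarrow> tuple \<Rightarrow> tuple \<Rightarrow> real" where
  "stage_cost P x u = (\<Sum>i\<in>subs P. cost P i (x i) (restrict x (nbrC P i)) (u i))"


section \<open>Optimal control problems\<close>

text \<open>
  Control sequences are indexed by absolute time: \<open>u t i\<close> is the input of subsystem \<open>i\<close> at
  time \<open>t\<close>.  \<open>pred_offset\<close> is indexed by the time elapsed since \<open>k\<close>.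
\<close>

primrec pred_offset :: "network \<Rightarrow> nat \<Rightarrow> tuple \<Rightarrow> (nat \<Rightarrow> tuple) \<Rightarrow> nat \<Rightarrow> tuple" where
  "pred_offset P k x u 0 = x"
| "pred_offset P k x u (Suc d) = step P (pred_offset P k x u d) (u (k + d))"

definition predict :: "network \<Rightarrow> nat \<Rightarrow> tuple \<Rightarrow> (nat \<Rightarrow> tuple) \<Rightarrow> nat \<Rightarrow> tuple" where
  "predict P k x u t = pred_offset P k x u (t - k)"

definition J_fin :: "network \<Rightarrow> nat \<Rightarrow> nat \<Rightarrow> tuple \<Rightarrow> (nat \<Rightarrow> tuple) \<Rightarrow> real" where
  "J_fin P T k x u = (\<Sum>t = k..k + T. stage_cost P (predict P k x u t) (u t))"

text \<open>
  The infinite sum of nonnegative stage costs is taken in \<open>[0, \<infinity>]\<close>, so that divergence has the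
  value \<open>\<infinity>\<close> (a real-valued \<open>suminf\<close> would be meaningless there).
\<close>

definition J_inf :: "network \<Rightarrow> nat \<Rightarrow> tuple \<Rightarrow> (nat \<Rightarrow> tuple) \<Rightarrow> ennreal" where
  "J_inf P k x u = (\<Sum>d. ennreal (stage_cost P (predict P k x u (k + d)) (u (k + d))))"

text \<open>
  \<open>W\<close> is the set of time instants of the problem: \<open>{k..k + T}\<close> or \<open>{k..}\<close>.  Control sequences are
  extensional on \<open>W\<close>, so that uniqueness of a minimizer is equality of functions.
\<close>

definition admissible :: "network \<Rightarrow> nat \<Rightarrow> nat set \<Rightarrow> tuple \<Rightarrow> (nat \<Rightarrow> tuple) set" where
  "admissible P k W x =
     {u \<in> W \<rightarrow>\<^sub>E inputs P. \<forall>t\<in>W. \<forall>i\<in>subs P. predict P k x u t i \<in> Xset P i}"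

text \<open>\<open>LEAST\<close> over a set of values is its minimum, which exists under \<open>ocp_assumption\<close>.\<close>

definition V_fin :: "network \<Rightarrow> nat \<Rightarrow> nat \<Rightarrow> tuple \<Rightarrow> real" where
  "V_fin P T k x = (LEAST c. \<exists>u\<in>admissible P k {k..k + T} x. c = J_fin P T k x u)"

definition V_inf :: "network \<Rightarrow> nat \<Rightarrow> tuple \<Rightarrow> ennreal" where
  "V_inf P k x = (LEAST c. \<exists>u\<in>admissible P k {k..} x. c = J_inf P k x u)"

text \<open>
  Continuity refers to the product topology on \<open>nat \<Rightarrow> real\<close>; on \<open>real_space {..<n}\<close> it induces the
  Euclidean topology of \<open>\<real>\<^sup>n\<close>.
\<close>

definition cost_assumption :: "network \<Rightarrow> bool" where
  "cost_assumption P \<longleftrightarrow>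
     (\<forall>i\<in>subs P. \<forall>w\<in>Pi\<^sub>E (nbrC P i) (Xset P). \<forall>u\<in>Uset P i.
        continuous_on (Xset P i) (\<lambda>x. cost P i x w u) \<and>
        (\<forall>x\<in>Xset P i. cost P i x w u = 0 \<longleftrightarrow> x = (\<lambda>r\<in>{..<dimx P i}. 0)))"

definition ocp_assumption :: "network \<Rightarrow> bool" where
  "ocp_assumption P \<longleftrightarrow>
     (\<forall>k. \<forall>x\<in>states P.
        (\<forall>H. \<exists>!u. is_arg_min (J_fin P H k x) (\<lambda>u. u \<in> admissible P k {k..k + H} x) u) \<and>
        (\<exists>!u. is_arg_min (J_inf P k x) (\<lambda>u. u \<in> admissible P k {k..} x) u))"


section \<open>Forecast vectors and local constraint sets\<close>

text \<open>
  Coordinates of the stacked vector \<open>y\<^sub>i[t] = [x\<^sub>i; w\<^sub>i; u\<^sub>i; v\<^sub>i]\<close>: \<open>WC j r\<close> and \<open>VC j r\<close> are the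
  \<open>r\<close>-th coordinates of subsystem \<open>i\<close>'s copies of \<open>x\<^sub>j\<close> in \<open>w\<^sub>i\<close> and in \<open>v\<^sub>i\<close>.
\<close>

datatype ycoord = XC nat | WC nat nat | UC nat | VC nat nat

type_synonym yvec = "ycoord \<Rightarrow> real"

definition coords :: "network \<Rightarrow> nat \<Rightarrow> ycoord set" where
  "coords P i =
     {XC r | r. r < dimx P i} \<union> {WC j r | j r. j \<in> nbrC P i \<and> r < dimx P j} \<union>
     {UC r | r. r < dimu P i} \<union> {VC j r | j r. j \<in> nbrP P i \<and> r < dimx P j}"

definition xpart :: "network \<Rightarrow> nat \<Rightarrow> yvec \<Rightarrow> vect" where
  "xpart P i y = (\<lambda>r\<in>{..<dimx P i}. y (XC r))"

definition wpart :: "network \<Rightarrow> nat \<Rightarrow> yvec \<Rightarrow> tuple" where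
  "wpart P i y = (\<lambda>j\<in>nbrC P i. \<lambda>r\<in>{..<dimx P j}. y (WC j r))"

definition upart :: "network \<Rightarrow> nat \<Rightarrow> yvec \<Rightarrow> vect" where
  "upart P i y = (\<lambda>r\<in>{..<dimu P i}. y (UC r))"

definition vpart :: "network \<Rightarrow> nat \<Rightarrow> yvec \<Rightarrow> tuple" where
  "vpart P i y = (\<lambda>j\<in>nbrP P i. \<lambda>r\<in>{..<dimx P j}. y (VC j r))"

definition ycost :: "network \<Rightarrow> nat \<Rightarrow> yvec \<Rightarrow> real" where
  "ycost P i y = cost P i (xpart P i y) (wpart P i y) (upart P i y)"

definition ydomain :: "network \<Rightarrow> nat \<Rightarrow> yvec set" where
  "ydomain P i =
     {y \<in> real_space (coords P i). xpart P i y \<in> Xset P i \<and>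
        wpart P i y \<in> Pi\<^sub>E (nbrC P i) (Xset P) \<and> upart P i y \<in> Uset P i}"

definition ynorm :: "network \<Rightarrow> nat \<Rightarrow> yvec \<Rightarrow> real" where
  "ynorm P i y = L2_set y (coords P i)"

text \<open>
  \<open>xh s j\<close> is the forecast state of subsystem \<open>j\<close> at time \<open>s\<close> (\<open>i\<close> itself or a neighbour); only
  the state of \<open>i\<close> is pinned to the measured one at time \<open>k\<close>.
\<close>

definition Cset :: "network \<Rightarrow> nat \<Rightarrow> tuple \<Rightarrow> nat \<Rightarrow> nat \<Rightarrow> yvec set" where
  "Cset P k x i t =
     {y \<in> real_space (coords P i).
        \<exists>(xh :: nat \<Rightarrow> tuple) (wb :: nat \<Rightarrow> tuple) (uh :: nat \<Rightarrow> vect) (vb :: nat \<Rightarrow> tuple).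
          xpart P i y = xh t i \<and> wpart P i y = wb t \<and> upart P i y = uh t \<and> vpart P i y = vb t \<and>
          xh k i = x i \<and>
          (\<forall>s\<in>{k..t}.
             xh (Suc s) i = dyn P i (xh s i) (vb s) (uh s) \<and>
             xh s i \<in> Xset P i \<and> uh s \<in> Uset P i \<and>
             (\<forall>j\<in>nbrP P i \<union> nbrC P i. xh s j \<in> Xset P j) \<and>
             wb s = restrict (xh s) (nbrC P i) \<and> vb s = restrict (xh s) (nbrP P i))}"

definition yconvex :: "network \<Rightarrow> nat \<Rightarrow> yvec set \<Rightarrow> bool" where
  "yconvex P i C \<longleftrightarrow>
     (\<forall>y\<in>C. \<forall>z\<in>C. \<forall>a\<in>{0..1}. (\<lambda>c\<in>coords P i. (1 - a) * y c + a * z c) \<in> C)"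

definition is_projection :: "network \<Rightarrow> nat \<Rightarrow> yvec set \<Rightarrow> yvec \<Rightarrow> yvec \<Rightarrow> bool" where
  "is_projection P i C z p \<longleftrightarrow>
     is_arg_min (\<lambda>q. ynorm P i (\<lambda>c. z c - q c)) (\<lambda>q. q \<in> C) p"

definition projection :: "network \<Rightarrow> nat \<Rightarrow> yvec set \<Rightarrow> yvec \<Rightarrow> yvec" where
  "projection P i C z = (THE p. is_projection P i C z p)"

definition constraint_assumption :: "network \<Rightarrow> nat \<Rightarrow> bool" where
  "constraint_assumption P T \<longleftrightarrow>
     (\<forall>k. \<forall>x\<in>states P. \<forall>i\<in>subs P. \<forall>t\<in>{k..k + T}.
        yconvex P i (Cset P k x i t) \<and>
        (\<forall>z\<in>real_space (coords P i). \<exists>!p. is_projection P i (Cset P k x i t) z p))"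


section \<open>The ADMM procedure\<close>

text \<open>
  \<open>Y s i t\<close>, \<open>Z s i t\<close>, \<open>G s i t\<close> stand for \<open>y\<^sub>i[t]\<close>, \<open>\<zeta>\<^sub>i[t]\<close>, \<open>\<gamma>\<^sub>i[t]\<close> at iteration \<open>s \<ge> 1\<close>.
\<close>

type_synonym iterates = "nat \<Rightarrow> nat \<Rightarrow> nat \<Rightarrow> yvec"

definition local_objective ::
  "network \<Rightarrow> nat \<Rightarrow> real \<Rightarrow> nat \<Rightarrow> nat \<Rightarrow> (nat \<Rightarrow> yvec) \<Rightarrow> (nat \<Rightarrow> yvec) \<Rightarrow> (nat \<Rightarrow> yvec) \<Rightarrow> real" where
  "local_objective P T \<rho> k i z g y =
     (\<Sum>t = k..k + T. ycost P i (y t) + \<rho> / 2 * (ynorm P i (\<lambda>c. y t c - z t c - g t c))\<^sup>2)"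

definition admm_iterates ::
  "network \<Rightarrow> nat \<Rightarrow> real \<Rightarrow> nat \<Rightarrow> tuple \<Rightarrow> iterates \<Rightarrow> iterates \<Rightarrow> iterates \<Rightarrow> bool" where
  "admm_iterates P T \<rho> k x Y Z G \<longleftrightarrow>
     (\<forall>i\<in>subs P.
        (\<forall>t\<in>{k..k + T}. Z 1 i t \<in> real_space (coords P i) \<and> G 1 i t \<in> real_space (coords P i)) \<and>
        (\<forall>s\<ge>1.
           is_arg_min (local_objective P T \<rho> k i (Z s i) (G s i))
             (\<lambda>y. \<forall>t\<in>{k..k + T}. y t \<in> ydomain P i) (Y s i) \<and>
           (\<forall>t\<in>{k..k + T}.
              Z (Suc s) i t =
                projection P i (Cset P k x i t) (\<lambda>c\<in>coords P i. Y s i t c + G s i t c) \<and>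
              G (Suc s) i t =
                (\<lambda>c\<in>coords P i. G s i t c + (Y s i t c - Z (Suc s) i t c)))))"

definition admm_value ::
  "network \<Rightarrow> nat \<Rightarrow> real \<Rightarrow> nat \<Rightarrow> iterates \<Rightarrow> iterates \<Rightarrow> iterates \<Rightarrow> nat \<Rightarrow> real" where
  "admm_value P T \<rho> k Y Z G s =
     (\<Sum>t = k..k + T. \<Sum>i\<in>subs P.
        ycost P i (Y s i t) + \<rho> / 2 * (ynorm P i (\<lambda>c. Y s i t c - Z s i t c - G s i t c))\<^sup>2)"

text \<open>
  The initialization at time \<open>k\<close>, and the choice among several minimizers, may depend on the whole
  past of the closed loop (e.g. warm starts).  That past is determined by the initial state and the
  iteration numbers \<open>S\<^sub>0, \<dots>, S\<^sub>k\<^sub>-\<^sub>1\<close>, so a run of the procedure is a function of these: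
  \<open>y x0 [S\<^sub>0, \<dots>, S\<^sub>k\<^sub>-\<^sub>1]\<close> is the sequence of iterates generated at time \<open>k\<close> (for all iterations, whether
  or not they are carried out before the control is applied).
\<close>

type_synonym procedure = "tuple \<Rightarrow> nat list \<Rightarrow> iterates"

definition past :: "(nat \<Rightarrow> nat) \<Rightarrow> nat \<Rightarrow> nat list" where
  "past S k = map S [0..<k]"

definition applied :: "network \<Rightarrow> procedure \<Rightarrow> tuple \<Rightarrow> (nat \<Rightarrow> nat) \<Rightarrow> nat \<Rightarrow> tuple" where
  "applied P y x0 S k = (\<lambda>i\<in>subs P. upart P i (y x0 (past S k) (S k) i k))"

primrec closed_loop :: "network \<Rightarrow> procedure \<Rightarrow> tuple \<Rightarrow> (nat \<Rightarrow> nat) \<Rightarrow> nat \<Rightarrow> tuple" where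
  "closed_loop P y x0 S 0 = x0"
| "closed_loop P y x0 S (Suc k) = step P (closed_loop P y x0 S k) (applied P y x0 S k)"

definition admm_procedure ::
  "network \<Rightarrow> nat \<Rightarrow> real \<Rightarrow> procedure \<Rightarrow> procedure \<Rightarrow> procedure \<Rightarrow> bool" where
  "admm_procedure P T \<rho> y \<zeta> \<gamma> \<longleftrightarrow>
     (\<forall>x0\<in>states P. \<forall>S. (\<forall>k. 1 \<le> S k) \<longrightarrow>
        (\<forall>k. admm_iterates P T \<rho> k (closed_loop P y x0 S k)
               (y x0 (past S k)) (\<zeta> x0 (past S k)) (\<gamma> x0 (past S k))))"

text \<open>\<open>V\<^sub>k\<close> with horizon \<open>T\<close> after \<open>s\<close> iterations, at time \<open>k\<close> of the closed loop given by \<open>x0\<close>, \<open>S\<close>.\<close>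

definition V_admm ::
  "network \<Rightarrow> nat \<Rightarrow> real \<Rightarrow> procedure \<Rightarrow> procedure \<Rightarrow> procedure \<Rightarrow> tuple \<Rightarrow> (nat \<Rightarrow> nat) \<Rightarrow> nat \<Rightarrow> nat \<Rightarrow> real"
  where
  "V_admm P T \<rho> y \<zeta> \<gamma> x0 S k s =
     admm_value P T \<rho> k (y x0 (past S k)) (\<zeta> x0 (past S k)) (\<gamma> x0 (past S k)) s"

end

theory Submission
  imports Defs
begin

text \<open>
  The error sequence is built to telescope: for \<open>k \<ge> 1\<close> it equals
  \<open>e k = \<alpha> \<Sum>\<^sub>j\<^sub><\<^sub>k c\<^sub>j + Vt k (x k) - V 0\<close>, where \<open>c\<^sub>j\<close> is the stage cost of the closed loop at time \<open>j\<close> and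
  \<open>V 0\<close> is the ADMM value at time \<open>0\<close>.  The decrease condition at time \<open>k\<close>, together with
  \<open>V k \<le> Vt k (x k)\<close>, therefore bounds the cost accumulated since time \<open>0\<close>, rather than that of a
  single step: \<open>\<alpha> \<Sum>\<^sub>j\<^sub>\<le>\<^sub>k c\<^sub>j + Vt (k + 1) (x (k + 1)) \<le> V 0\<close> (\<open>accumulated_decrease\<close>).  The functions
  \<open>Vt k\<close> are nonnegative on the state space, which the closed loop never leaves
  (\<open>closed_loop_in_states\<close>), so \<open>\<alpha> J\<^sub>0 \<le> V 0\<close>.

  It remains to compare \<open>V 0\<close> with the infinite-horizon optimum.  Nothing has happened before time
  \<open>0\<close>, so the iterates there depend on the initial state only, and by convergence some \<open>S\<^sub>0\<close>, chosen
  before all other iteration numbers, makes \<open>V 0\<close> at most the finite-horizon optimum plus \<open>\<epsilon>\<close>.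
  Truncating an optimal infinite control sequence shows that the finite-horizon optimum does not
  exceed the infinite-horizon one (\<open>V_fin_le_V_inf\<close>).
\<close>

section \<open>State constraints and nonnegativity of the cost\<close>

lemma restrict_neighbours:
  assumes "E \<subseteq> subs P \<times> subs P" and "\<And>i. i \<in> subs P \<Longrightarrow> x i \<in> Xset P i"
  shows "restrict x {j. (j, i) \<in> E} \<in> Pi\<^sub>E {j. (j, i) \<in> E} (Xset P)"
  using assms by auto

lemma stage_cost_nonneg:
  assumes ok: "network_ok P"
    and x: "\<And>i. i \<in> subs P \<Longrightarrow> x i \<in> Xset P i"
    and u: "u \<in> inputs P"
  shows "0 \<le> stage_cost P x u"
  unfolding stage_cost_def
proof (rule sum_nonneg)
  fix i assume i: "i \<in> subs P"
  have "restrict x (nbrC P i) \<in> Pi\<^sub>E (nbrC P i) (Xset P)"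
    unfolding nbrC_def by (rule restrict_neighbours) (use ok x in \<open>auto simp: network_ok_def\<close>)
  moreover have "u i \<in> Uset P i"
    using u i by (auto simp: inputs_def)
  ultimately show "0 \<le> cost P i (x i) (restrict x (nbrC P i)) (u i)"
    using ok x i by (auto simp: network_ok_def)
qed

lemma step_in_states:
  assumes ok: "network_ok P" and x: "x \<in> states P" and u: "u \<in> inputs P"
  shows "step P x u \<in> states P"
proof -
  have xi: "x i \<in> Xset P i" if "i \<in> subs P" for i
    using x that by (auto simp: states_def)
  have "dyn P i (x i) (restrict x (nbrP P i)) (u i) \<in> Xset P i" if i: "i \<in> subs P" for i
  proof -
    have "restrict x (nbrP P i) \<in> Pi\<^sub>E (nbrP P i) (Xset P)"
      unfolding nbrP_def by (rule restrict_neighbours) (use ok xi in \<open>auto simp: network_ok_def\<close>)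
    moreover have "u i \<in> Uset P i"
      using u i by (auto simp: inputs_def)
    ultimately show ?thesis
      using ok xi i by (auto simp: network_ok_def)
  qed
  then show ?thesis
    by (auto simp: step_def states_def)
qed


section \<open>The closed loop\<close>

text \<open>
  ADMM iterates need not satisfy the dynamics, nor the coupling between subsystems, but the local
  minimizations range over the domain of the cost; hence each applied input is an admissible one.
\<close>

lemma applied_in_inputs:
  assumes "admm_procedure P T \<rho> y \<zeta> \<gamma>" "x0 \<in> states P" "\<And>j. 1 \<le> S j"
  shows "applied P y x0 S k \<in> inputs P"
proof -
  have "admm_iterates P T \<rho> k (closed_loop P y x0 S k)
          (y x0 (past S k)) (\<zeta> x0 (past S k)) (\<gamma> x0 (past S k))"
    using assms by (auto simp: admm_procedure_def)
  then have "y x0 (past S k) (S k) i k \<in> ydomain P i" if "i \<in> subs P" for i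
    using that assms(3)[of k] by (auto simp: admm_iterates_def is_arg_min_def)
  then show ?thesis
    by (auto simp: applied_def inputs_def ydomain_def)
qed

lemma closed_loop_in_states:
  assumes "network_ok P" "admm_procedure P T \<rho> y \<zeta> \<gamma>" "x0 \<in> states P" "\<And>j. 1 \<le> S j"
  shows "closed_loop P y x0 S k \<in> states P"
proof (induction k)
  case 0
  show ?case using assms by simp
next
  case (Suc k)
  then show ?case
    using step_in_states[OF assms(1)] applied_in_inputs[OF assms(2-4)] by simp
qed

text \<open>
  The plant model is exact, so predicting from \<open>x0\<close> with the applied inputs reproduces the closed
  loop; this identifies \<open>J_inf\<close> with the cost actually incurred.
\<close>

lemma predict_applied: "predict P 0 x0 (applied P y x0 S) k = closed_loop P y x0 S k"
proof -
  have "pred_offset P 0 x0 (applied P y x0 S) k = closed_loop P y x0 S k"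
    by (induction k) auto
  then show ?thesis by (simp add: predict_def)
qed


section \<open>Finite-horizon and infinite-horizon optima\<close>

lemma predict_cong:
  assumes "\<And>s. k \<le> s \<Longrightarrow> s < t \<Longrightarrow> u s = u' s"
  shows "predict P k x u t = predict P k x u' t"
proof -
  have "pred_offset P k x u d = pred_offset P k x u' d" if "d \<le> t - k" for d
    using that by (induction d) (auto simp: assms)
  then show ?thesis by (simp add: predict_def)
qed

lemma Least_eq_arg_min:
  fixes f :: "'a \<Rightarrow> 'b :: linorder"
  assumes "is_arg_min f (\<lambda>u. u \<in> A) u"
  shows "(LEAST c. \<exists>v\<in>A. c = f v) = f u"
  using assms by (intro Least_equality) (auto simp: is_arg_min_linorder)

lemma V_fin_le_J_fin:
  assumes "ocp_assumption P" "x \<in> states P" "u \<in> admissible P k {k..k + T} x"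
  shows "V_fin P T k x \<le> J_fin P T k x u"
proof -
  obtain v where v: "is_arg_min (J_fin P T k x) (\<lambda>u. u \<in> admissible P k {k..k + T} x) v"
    using assms(1,2) unfolding ocp_assumption_def by blast
  have "V_fin P T k x = J_fin P T k x v"
    unfolding V_fin_def by (rule Least_eq_arg_min[OF v])
  then show ?thesis
    using v assms(3) by (auto simp: is_arg_min_linorder)
qed

lemma V_inf_attained:
  assumes "ocp_assumption P" "x \<in> states P"
  obtains u where "u \<in> admissible P k {k..} x" "V_inf P k x = J_inf P k x u"
proof -
  obtain u where u: "is_arg_min (J_inf P k x) (\<lambda>u. u \<in> admissible P k {k..} x) u"
    using assms unfolding ocp_assumption_def by blast
  have "V_inf P k x = J_inf P k x u"
    unfolding V_inf_def by (rule Least_eq_arg_min[OF u])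
  with u show thesis
    by (intro that) (auto simp: is_arg_min_linorder)
qed

lemma admissible_truncate:
  assumes u: "u \<in> admissible P k {k..} x"
  shows "restrict u {k..k + T} \<in> admissible P k {k..k + T} x"
    and "J_fin P T k x (restrict u {k..k + T}) = J_fin P T k x u"
proof -
  have pred: "predict P k x (restrict u {k..k + T}) t = predict P k x u t" if "t \<in> {k..k + T}" for t
    by (rule predict_cong) (use that in auto)
  show "restrict u {k..k + T} \<in> admissible P k {k..k + T} x"
    using u pred unfolding admissible_def by auto
  show "J_fin P T k x (restrict u {k..k + T}) = J_fin P T k x u"
    unfolding J_fin_def by (rule sum.cong) (auto simp: pred)
qed

lemma J_fin_le_J_inf:
  assumes ok: "network_ok P" and u: "u \<in> admissible P k {k..} x"
  shows "ennreal (J_fin P T k x u) \<le> J_inf P k x u"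
proof -
  let ?c = "\<lambda>t. stage_cost P (predict P k x u t) (u t)"
  have nonneg: "0 \<le> ?c t" if "k \<le> t" for t
    using u that by (intro stage_cost_nonneg[OF ok]) (auto simp: admissible_def)
  have "J_fin P T k x u = (\<Sum>d<Suc T. ?c (k + d))"
    unfolding J_fin_def
    by (rule sum.reindex_bij_witness[of _ "\<lambda>d. k + d" "\<lambda>t. t - k"]) auto
  then have "ennreal (J_fin P T k x u) = (\<Sum>d<Suc T. ennreal (?c (k + d)))"
    by (simp add: nonneg sum_nonneg sum_ennreal del: sum.lessThan_Suc)
  also have "\<dots> \<le> (\<Sum>d. ennreal (?c (k + d)))"
    by (rule sum_le_suminf) auto
  finally show ?thesis unfolding J_inf_def .
qed

lemma V_fin_le_V_inf:
  assumes ok: "network_ok P" and ocp: "ocp_assumption P" and x: "x \<in> states P"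
  shows "ennreal (V_fin P T k x) \<le> V_inf P k x"
proof -
  obtain u where u: "u \<in> admissible P k {k..} x" and V: "V_inf P k x = J_inf P k x u"
    using V_inf_attained[OF ocp x] by blast
  have "V_fin P T k x \<le> J_fin P T k x u"
    using V_fin_le_J_fin[OF ocp x admissible_truncate(1)[OF u]] admissible_truncate(2)[OF u] by metis
  then have "ennreal (V_fin P T k x) \<le> ennreal (J_fin P T k x u)"
    by (rule ennreal_leI)
  also have "\<dots> \<le> J_inf P k x u"
    by (rule J_fin_le_J_inf[OF ok u])
  finally show ?thesis by (simp add: V)
qed


section \<open>The bound on the closed-loop cost\<close>

text \<open>
  Summing its increments gives \<open>e k = (\<Sum>j<k. c j) + W k - V 0\<close> for \<open>k \<ge> 1\<close>.  The decrease
  condition at \<open>k\<close> contains \<open>W k\<close> with the sign that lets it cancel against \<open>V k \<le> W k\<close>.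
\<close>

lemma accumulated_decrease:
  fixes c V W e :: "nat \<Rightarrow> real"
  assumes e0: "e 0 = 0"
    and e1: "e 1 = c 0 + W 1 - V 0"
    and eSuc: "\<And>k. 2 \<le> k \<Longrightarrow> e k = e (k - 1) + c (k - 1) + W k - W (k - 1)"
    and upper: "\<And>k. V k \<le> W k"
    and decrease: "\<And>k. e k + c k \<le> V k - W (k + 1)"
  shows "(\<Sum>j\<le>k. c j) + W (Suc k) \<le> V 0"
proof -
  have e: "e (Suc k) = (\<Sum>j\<le>k. c j) + W (Suc k) - V 0" for k
  proof (induction k)
    case 0
    show ?case using e1 by simp
  next
    case (Suc k)
    then show ?case using eSuc[of "Suc (Suc k)"] by simp
  qed
  show ?thesis
  proof (cases k)
    case 0
    then show ?thesis using e0 decrease[of 0] by simp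
  next
    case (Suc n)
    then show ?thesis using e[of n] upper[of k] decrease[of k] by simp
  qed
qed

lemma suminf_ennreal_le:
  fixes c :: "nat \<Rightarrow> real"
  assumes "0 \<le> \<alpha>" and c: "\<And>k. 0 \<le> c k" and bound: "\<And>k. (\<Sum>j\<le>k. \<alpha> * c j) \<le> B"
  shows "ennreal \<alpha> * (\<Sum>k. ennreal (c k)) \<le> ennreal B"
proof -
  have "ennreal \<alpha> * (\<Sum>k. ennreal (c k)) = (\<Sum>k. ennreal (\<alpha> * c k))"
    using assms by (simp add: ennreal_mult)
  also have "\<dots> \<le> ennreal B"
  proof (rule suminf_le_const)
    fix n
    have "(\<Sum>j<n. ennreal (\<alpha> * c j)) = ennreal (\<Sum>j<n. \<alpha> * c j)"
      using assms by (simp add: sum_ennreal)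
    also have "(\<Sum>j<n. \<alpha> * c j) \<le> (\<Sum>j\<le>n. \<alpha> * c j)"
      using assms by (intro sum_mono2) auto
    then have "ennreal (\<Sum>j<n. \<alpha> * c j) \<le> ennreal B"
      using bound[of n] by (intro ennreal_leI) linarith
    finally show "(\<Sum>j<n. ennreal (\<alpha> * c j)) \<le> ennreal B" .
  qed simp
  finally show ?thesis .
qed

theorem proposition3p3:
  fixes P :: network and T :: nat and \<rho> \<alpha> :: real
    and y \<zeta> \<gamma> :: procedure
    and Vt :: "nat \<Rightarrow> tuple \<Rightarrow> real"
  assumes "network_ok P"
    and "cost_assumption P"
    and "ocp_assumption P"
    and "constraint_assumption P T"
    and "\<rho> > 0"
    and "admm_procedure P T \<rho> y \<zeta> \<gamma>"
    and convergence: "\<And>x0 S k. x0 \<in> states P \<Longrightarrow> (\<And>j. 1 \<le> S j) \<Longrightarrow>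
          (\<lambda>s. V_admm P T \<rho> y \<zeta> \<gamma> x0 S k s) \<longlonglongrightarrow> V_fin P T k (closed_loop P y x0 S k)"
    and "\<And>k x. x \<in> states P \<Longrightarrow> 0 \<le> Vt k x"
    and "0 \<le> \<alpha>" and "\<alpha> \<le> 1"
  shows "\<forall>x0\<in>states P. \<forall>\<epsilon>>0. \<exists>S0\<ge>1. \<forall>(S :: nat \<Rightarrow> nat) (e :: nat \<Rightarrow> real).
     (let x = closed_loop P y x0 S;
          u = applied P y x0 S;
          V = (\<lambda>k. V_admm P T \<rho> y \<zeta> \<gamma> x0 S k (S k))
      in
        S 0 = S0 \<and> (\<forall>k. 1 \<le> S k) \<and>
        e 0 = 0 \<and>
        e 1 = \<alpha> * stage_cost P (x 0) (u 0) + Vt 1 (x 1) - V 0 \<and>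
        (\<forall>k\<ge>2. e k = e (k - 1) + \<alpha> * stage_cost P (x (k - 1)) (u (k - 1))
                       + Vt k (x k) - Vt (k - 1) (x (k - 1))) \<and>
        (\<forall>k. Vt k (x k) \<ge> V k \<and>
             V k - Vt (k + 1) (x (k + 1)) \<ge> e k + \<alpha> * stage_cost P (x k) (u k))
        \<longrightarrow> ennreal \<alpha> * J_inf P 0 x0 u \<le> V_inf P 0 x0 + ennreal \<epsilon>)"
proof (intro ballI allI impI)
  fix x0 :: tuple and \<epsilon> :: real
  assume x0: "x0 \<in> states P" and \<epsilon>: "0 < \<epsilon>"
  \<comment> \<open>The past at time \<open>0\<close> is empty, so any sequence of iteration numbers gives the same value there.\<close>
  have V0: "V_admm P T \<rho> y \<zeta> \<gamma> x0 S 0 s = V_admm P T \<rho> y \<zeta> \<gamma> x0 (\<lambda>_. 1) 0 s" for S s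
    by (simp add: V_admm_def past_def)
  have "(\<lambda>s. V_admm P T \<rho> y \<zeta> \<gamma> x0 (\<lambda>_. 1) 0 s) \<longlonglongrightarrow> V_fin P T 0 x0"
    using convergence[OF x0, of "\<lambda>_. 1" 0] by simp
  then have "\<forall>\<^sub>F s in sequentially. V_admm P T \<rho> y \<zeta> \<gamma> x0 (\<lambda>_. 1) 0 s < V_fin P T 0 x0 + \<epsilon>"
    by (rule order_tendstoD(2)) (use \<epsilon> in simp)
  then have "\<forall>\<^sub>F s in sequentially.
      1 \<le> s \<and> V_admm P T \<rho> y \<zeta> \<gamma> x0 (\<lambda>_. 1) 0 s < V_fin P T 0 x0 + \<epsilon>"
    by (intro eventually_conj eventually_ge_at_top)
  then obtain S0 where S0: "1 \<le> S0"
      "V_admm P T \<rho> y \<zeta> \<gamma> x0 (\<lambda>_. 1) 0 S0 < V_fin P T 0 x0 + \<epsilon>"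
    using eventually_happens'[OF sequentially_bot] by blast
  have main: "ennreal \<alpha> * J_inf P 0 x0 (applied P y x0 S) \<le> V_inf P 0 x0 + ennreal \<epsilon>"
    if "S 0 = S0" and S: "\<And>k. 1 \<le> S k"
      and e0: "e 0 = 0"
      and e1: "e 1 = \<alpha> * stage_cost P (closed_loop P y x0 S 0) (applied P y x0 S 0)
             + Vt 1 (closed_loop P y x0 S 1) - V_admm P T \<rho> y \<zeta> \<gamma> x0 S 0 (S 0)"
      and eSuc: "\<And>k. 2 \<le> k \<Longrightarrow> e k = e (k - 1)
             + \<alpha> * stage_cost P (closed_loop P y x0 S (k - 1)) (applied P y x0 S (k - 1))
             + Vt k (closed_loop P y x0 S k) - Vt (k - 1) (closed_loop P y x0 S (k - 1))"
      and upper: "\<And>k. V_admm P T \<rho> y \<zeta> \<gamma> x0 S k (S k) \<le> Vt k (closed_loop P y x0 S k)"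
      and decrease: "\<And>k. e k + \<alpha> * stage_cost P (closed_loop P y x0 S k) (applied P y x0 S k)
             \<le> V_admm P T \<rho> y \<zeta> \<gamma> x0 S k (S k) - Vt (k + 1) (closed_loop P y x0 S (k + 1))"
    for S :: "nat \<Rightarrow> nat" and e :: "nat \<Rightarrow> real"
  proof -
    let ?x = "closed_loop P y x0 S"
    let ?c = "\<lambda>k. stage_cost P (?x k) (applied P y x0 S k)"
    let ?V = "V_admm P T \<rho> y \<zeta> \<gamma> x0 S"
    have x: "?x k \<in> states P" for k
      by (rule closed_loop_in_states[OF assms(1,6) x0 S])
    have c: "0 \<le> ?c k" for k
      using x[of k] applied_in_inputs[OF assms(6) x0 S]
      by (intro stage_cost_nonneg[OF assms(1)]) (auto simp: states_def)
    have "(\<Sum>j\<le>k. \<alpha> * ?c j) \<le> ?V 0 (S 0)" for k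
      using accumulated_decrease[of e "\<lambda>k. \<alpha> * ?c k" "\<lambda>k. Vt k (?x k)" "\<lambda>k. ?V k (S k)" k,
          OF e0 e1 eSuc upper decrease] assms(8)[OF x, of "Suc k" "Suc k"]
      by simp
    then have "ennreal \<alpha> * (\<Sum>k. ennreal (?c k)) \<le> ennreal (?V 0 (S 0))"
      by (rule suminf_ennreal_le[OF \<open>0 \<le> \<alpha>\<close> c])
    then have "ennreal \<alpha> * J_inf P 0 x0 (applied P y x0 S) \<le> ennreal (?V 0 (S 0))"
      by (simp add: J_inf_def predict_applied)
    also have "\<dots> \<le> ennreal (V_fin P T 0 x0 + \<epsilon>)"
      using S0(2) \<open>S 0 = S0\<close> V0[of S S0] by (intro ennreal_leI) simp
    also have "\<dots> \<le> ennreal (V_fin P T 0 x0) + ennreal \<epsilon>"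
      using \<epsilon> by (cases "0 \<le> V_fin P T 0 x0") (auto simp: ennreal_plus ennreal_neg intro!: ennreal_leI)
    also have "\<dots> \<le> V_inf P 0 x0 + ennreal \<epsilon>"
      by (intro add_right_mono V_fin_le_V_inf assms x0)
    finally show ?thesis .
  qed
  show "\<exists>S0\<ge>1. \<forall>(S :: nat \<Rightarrow> nat) (e :: nat \<Rightarrow> real).
     (let x = closed_loop P y x0 S;
          u = applied P y x0 S;
          V = (\<lambda>k. V_admm P T \<rho> y \<zeta> \<gamma> x0 S k (S k))
      in
        S 0 = S0 \<and> (\<forall>k. 1 \<le> S k) \<and>
        e 0 = 0 \<and>
        e 1 = \<alpha> * stage_cost P (x 0) (u 0) + Vt 1 (x 1) - V 0 \<and>
        (\<forall>k\<ge>2. e k = e (k - 1) + \<alpha> * stage_cost P (x (k - 1)) (u (k - 1))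
                       + Vt k (x k) - Vt (k - 1) (x (k - 1))) \<and>
        (\<forall>k. Vt k (x k) \<ge> V k \<and>
             V k - Vt (k + 1) (x (k + 1)) \<ge> e k + \<alpha> * stage_cost P (x k) (u k))
        \<longrightarrow> ennreal \<alpha> * J_inf P 0 x0 u \<le> V_inf P 0 x0 + ennreal \<epsilon>)"
    unfolding Let_def
    by (rule exI[of _ S0], intro conjI allI impI, rule S0(1), elim conjE, rule main) (assumption | metis)+
qed

end
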